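(* Let $n\ge 1$, let $\Omega\subset\mathbb{R}^3$ be a bounded Lipschitz domain, and let $\eta_i>0$, $\lambda_i,\mu_i$ ($0\le i\le n$) be bounded measurable functions on $\Omega$ (their dependence on $x$ is suppressed; all identities below hold for a.e. $x\in\Omega$) with $\mu_i\ge\delta$, $3\lambda_i+2\mu_i\ge\delta$ for some constant $\delta>0$. Let $u=u(t,x)\in\mathbb{R}^3$ be a displacement whose strain $e[u]=\frac12(\nabla u+(\nabla u)^{\mathfrak t})$ is continuously differentiable in $t\ge 0$, and let the symmetric $3\times3$-matrix valued functions $\phi_0,\dots,\phi_n$, $\psi$, $\sigma$ satisfy the constitutive equations of the isotropic extended Burgers model for $t\geq 0$: $$\psi=e[u]-\sum_{i=0}^n\phi_i,\qquad \sigma=C_0\psi,\qquad \eta_0\dot\phi_0=\sigma,\qquad \eta_i\dot\phi_i=\sigma-C_i\phi_i\quad(1\le i\le n),$$ with $\phi_1=\dots=\phi_n=0$ and $\psi=0$ at $t=0$. Then $$\sigma(t)=\Big(\lambda_0+\tfrac23\mu_0\Big)\int_0^t\sum_{j=0}^n(q_0^j)^2e^{-(t-s)\kappa_j}(\nabla\cdot\dot u)(s)\,ds\,I_3+2\mu_0\int_0^t\sum_{j=0}^n(v_0^j)^2e^{-(t-s)\tau_j}\big(e[\dot u]-3^{-1}(\nabla\cdot\dot u)I_3\big)(s)\,ds .$$ If moreover $e[u]=0$ at $t=0$, then $$\begin{aligned}\sigma(t)=&\big(\lambda_0+\tfrac23\mu_0\big)(\nabla\cdot u)(t)I_3+2\mu_0\big(e[u]-3^{-1}(\nabla\cdot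 u)I_3\big)(t)\\&-\big(\lambda_0+\tfrac23\mu_0\big)\int_0^t\sum_{j=0}^n\kappa_j(q_0^j)^2e^{-(t-s)\kappa_j}(\nabla\cdot u)(s)\,ds\,I_3\\&-2\mu_0\int_0^t\sum_{j=0}^n\tau_j(v_0^j)^2e^{-(t-s)\tau_j}\big(e[u]-3^{-1}(\nabla\cdot u)I_3\big)(s)\,ds.\end{aligned}$$
   Context: $I_3$ is the $3\times 3$ identity matrix, a dot denotes the time derivative, and $C_i$ is the isotropic elasticity tensor acting on symmetric matrices by $C_i\alpha=\lambda_i\,\mathrm{tr}(\alpha)I_3+2\mu_i\alpha$. Put $b:=\sum_{i=0}^n\eta_i^{-1}$. Rows and columns of $(n+1)\times(n+1)$ matrices are indexed by $0,1,\dots,n$. $L_1^S$ is the real symmetric $(n+1)\times(n+1)$ matrix with entries $(L_1^S)_{00}=-2b\mu_0$, $(L_1^S)_{ii}=-2\mu_i\eta_i^{-1}$ for $1\le i\le n$, $(L_1^S)_{0i}=(L_1^S)_{i0}=\eta_i^{-1}\big((2\mu_0)(2\mu_i)\big)^{1/2}$ for $1\le i\le n$, and all other entries $0$. $L_0^S$ is the real symmetric $(n+1)\times(n+1)$ matrix with entries $(L_0^S)_{00}=-b(3\lambda_0+2\mu_0)$, $(L_0^S)_{ii}=-\eta_i^{-1}(3\lambda_i+2\mu_i)$ for $1\le i\le n$, $(L_0^S)_{0i}=(L_0^S)_{i0}=\eta_i^{-1}\sqrt{(3\lambda_0+2\mu_0)(3\lambda_i+2\mu_i)}$ for $1\le i\le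 n$, and all other entries $0$. Both matrices are negative definite. $-\tau_0,\dots,-\tau_n$ (with $\tau_j>0$) are the eigenvalues of $L_1^S$, with orthonormal eigenvectors $v^0,\dots,v^n$, $L_1^Sv^j=-\tau_jv^j$, and $v_0^j$ is the component of $v^j$ with index $0$. Likewise $-\kappa_0,\dots,-\kappa_n$ (with $\kappa_j>0$) are the eigenvalues of $L_0^S$, with orthonormal eigenvectors $q^0,\dots,q^n$, $L_0^Sq^j=-\kappa_jq^j$, and $q_0^j$ is the component of $q^j$ with index $0$. *)

theory Defs
  imports "Jordan_Normal_Form.Char_Poly" "HOL-Analysis.Analysis"
begin

text \<open>Spatial vectors and tensors live in \<open>real ^ 3\<close> and \<open>real ^ 3 ^ 3\<close>; the
  matrices of size \<open>n + 1\<close>, with indices \<open>0, \<dots>, n\<close>, are those of Jordan_Normal_Form.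
  The infix notations of the latter that clash with HOL-Analysis are renamed.\<close>

no_notation vec_index (infixl "$" 100)
no_notation scalar_prod (infix "\<bullet>" 70)
notation vec_index (infixl "$v" 100)
notation scalar_prod (infix "\<bullet>v" 70)

abbreviation I3 :: "real ^ 3 ^ 3" where
  "I3 \<equiv> Finite_Cartesian_Product.mat 1"


section \<open>Bounded Lipschitz domains\<close>

text \<open>Near every boundary point, after an orthogonal change of coordinates, the domain is
  the region above the graph of a Lipschitz function of the first two coordinates.\<close>

definition lipschitz_boundary :: "(real ^ 3) set \<Rightarrow> bool" where
  "lipschitz_boundary \<Omega> \<longleftrightarrow>
     (\<forall>p \<in> frontier \<Omega>. \<exists>r > 0. \<exists>T :: real ^ 3 \<Rightarrow> real ^ 3. \<exists>\<gamma> :: real ^ 2 \<Rightarrow> real. \<exists>L.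
        orthogonal_transformation T \<and> L-lipschitz_on UNIV \<gamma> \<and>
        \<Omega> \<inter> ball p r = {x \<in> ball p r. \<gamma> (vector [T x $ 1, T x $ 2]) < T x $ 3})"

definition bounded_lipschitz_domain :: "(real ^ 3) set \<Rightarrow> bool" where
  "bounded_lipschitz_domain \<Omega> \<longleftrightarrow>
     open \<Omega> \<and> connected \<Omega> \<and> \<Omega> \<noteq> {} \<and> bounded \<Omega> \<and> lipschitz_boundary \<Omega>"

definition bounded_measurable_on :: "(real ^ 3) set \<Rightarrow> (real ^ 3 \<Rightarrow> real) \<Rightarrow> bool" where
  "bounded_measurable_on \<Omega> f \<longleftrightarrow> f \<in> borel_measurable (lebesgue_on \<Omega>) \<and> bounded (f ` \<Omega>)"


section \<open>Weak gradient and strain\<close>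

text \<open>Test functions are taken of class \<open>C\<^sup>1\<close> with compact support; for locally integrable
  functions this gives the same weak derivatives as smooth test functions (mollify).\<close>

definition test_function :: "(real ^ 3) set \<Rightarrow> (real ^ 3 \<Rightarrow> real) \<Rightarrow> (real ^ 3 \<Rightarrow> real ^ 3) \<Rightarrow> bool" where
  "test_function \<Omega> \<zeta> D\<zeta> \<longleftrightarrow>
     (\<forall>x. (\<zeta> has_derivative (\<lambda>h. D\<zeta> x \<bullet> h)) (at x)) \<and> continuous_on UNIV D\<zeta> \<and>
     compact (closure {x. \<zeta> x \<noteq> 0}) \<and> closure {x. \<zeta> x \<noteq> 0} \<subseteq> \<Omega>"

definition locally_integrable_on ::
    "(real ^ 3) set \<Rightarrow> (real ^ 3 \<Rightarrow> 'b :: euclidean_space) \<Rightarrow> bool" where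
  "locally_integrable_on \<Omega> f \<longleftrightarrow> (\<forall>K. compact K \<and> K \<subseteq> \<Omega> \<longrightarrow> f absolutely_integrable_on K)"

text \<open>\<open>G x $ k $ l\<close> is the weak partial derivative of the component \<open>f x $ k\<close> in the
  direction \<open>l\<close>.\<close>

definition weak_gradient_on ::
    "(real ^ 3) set \<Rightarrow> (real ^ 3 \<Rightarrow> real ^ 3) \<Rightarrow> (real ^ 3 \<Rightarrow> real ^ 3 ^ 3) \<Rightarrow> bool" where
  "weak_gradient_on \<Omega> f G \<longleftrightarrow>
     locally_integrable_on \<Omega> f \<and> locally_integrable_on \<Omega> G \<and>
     (\<forall>\<zeta> D\<zeta>. test_function \<Omega> \<zeta> D\<zeta> \<longrightarrow>
        (\<forall>k l. (LINT x|lebesgue_on \<Omega>. f x $ k * D\<zeta> x $ l) =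
              - (LINT x|lebesgue_on \<Omega>. G x $ k $ l * \<zeta> x)))"

text \<open>Strain and divergence of a displacement, as functions of its gradient.\<close>

definition strain :: "real ^ 3 ^ 3 \<Rightarrow> real ^ 3 ^ 3" where
  "strain G = (1/2) *\<^sub>R (G + Finite_Cartesian_Product.transpose G)"

definition divergence :: "real ^ 3 ^ 3 \<Rightarrow> real" where
  "divergence G = trace G"


section \<open>Time derivatives on the half line (one-sided at 0)\<close>

text \<open>Only the strain, not the displacement itself, is assumed differentiable in time; the strain
  and divergence of the velocity are the time derivatives of those of the displacement.\<close>

definition time_differentiable :: "(real \<Rightarrow> 'a :: real_normed_vector) \<Rightarrow> bool" where
  "time_differentiable f \<longleftrightarrow> (\<forall>t\<ge>0. f differentiable (at t within {0..}))"

definition time_deriv :: "(real \<Rightarrow> 'a :: real_normed_vector) \<Rightarrow> real \<Rightarrow> 'a" where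
  "time_deriv f t = vector_derivative f (at t within {0..})"

definition time_C1 :: "(real \<Rightarrow> 'a :: real_normed_vector) \<Rightarrow> bool" where
  "time_C1 f \<longleftrightarrow> time_differentiable f \<and> continuous_on {0..} (time_deriv f)"


section \<open>The isotropic extended Burgers model\<close>

definition elasticity :: "real \<Rightarrow> real \<Rightarrow> real ^ 3 ^ 3 \<Rightarrow> real ^ 3 ^ 3" where
  "elasticity lam mu \<alpha> = (lam * trace \<alpha>) *\<^sub>R I3 + (2 * mu) *\<^sub>R \<alpha>"

text \<open>The constitutive equations at a fixed point of the body; \<open>e\<close> is the strain there as a
  function of time.\<close>

definition burgers_model ::
    "nat \<Rightarrow> (nat \<Rightarrow> real) \<Rightarrow> (nat \<Rightarrow> real) \<Rightarrow> (nat \<Rightarrow> real) \<Rightarrow> (real \<Rightarrow> real ^ 3 ^ 3) \<Rightarrow>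
     (nat \<Rightarrow> real \<Rightarrow> real ^ 3 ^ 3) \<Rightarrow> (real \<Rightarrow> real ^ 3 ^ 3) \<Rightarrow> (real \<Rightarrow> real ^ 3 ^ 3) \<Rightarrow> bool" where
  "burgers_model n \<eta> lam mu e \<phi> \<psi> \<sigma> \<longleftrightarrow>
     (\<forall>i\<in>{0..n}. time_differentiable (\<phi> i)) \<and>
     (\<forall>t\<ge>0.
        \<psi> t = e t - (\<Sum>i=0..n. \<phi> i t) \<and>
        \<sigma> t = elasticity (lam 0) (mu 0) (\<psi> t) \<and>
        \<eta> 0 *\<^sub>R time_deriv (\<phi> 0) t = \<sigma> t \<and>
        (\<forall>i\<in>{1..n}. \<eta> i *\<^sub>R time_deriv (\<phi> i) t = \<sigma> t - elasticity (lam i) (mu i) (\<phi> i t)))"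


section \<open>The relaxation matrices\<close>

definition L1S :: "nat \<Rightarrow> (nat \<Rightarrow> real) \<Rightarrow> (nat \<Rightarrow> real) \<Rightarrow> real mat" where
  "L1S n \<eta> mu = Matrix.mat (n + 1) (n + 1) (\<lambda>(i, j).
     if i = 0 \<and> j = 0 then - 2 * (\<Sum>k=0..n. inverse (\<eta> k)) * mu 0
     else if i = j then - 2 * mu i * inverse (\<eta> i)
     else if i = 0 then inverse (\<eta> j) * sqrt ((2 * mu 0) * (2 * mu j))
     else if j = 0 then inverse (\<eta> i) * sqrt ((2 * mu 0) * (2 * mu i))
     else 0)"

definition L0S :: "nat \<Rightarrow> (nat \<Rightarrow> real) \<Rightarrow> (nat \<Rightarrow> real) \<Rightarrow> (nat \<Rightarrow> real) \<Rightarrow> real mat" where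
  "L0S n \<eta> lam mu = Matrix.mat (n + 1) (n + 1) (\<lambda>(i, j).
     if i = 0 \<and> j = 0 then - (\<Sum>k=0..n. inverse (\<eta> k)) * (3 * lam 0 + 2 * mu 0)
     else if i = j then - inverse (\<eta> i) * (3 * lam i + 2 * mu i)
     else if i = 0 then inverse (\<eta> j) * sqrt ((3 * lam 0 + 2 * mu 0) * (3 * lam j + 2 * mu j))
     else if j = 0 then inverse (\<eta> i) * sqrt ((3 * lam 0 + 2 * mu 0) * (3 * lam i + 2 * mu i))
     else 0)"

text \<open>\<open>- \<tau> 0, \<dots>, - \<tau> n\<close> are the eigenvalues of \<open>A\<close> (with multiplicity) and \<open>v 0, \<dots>, v n\<close>
  associated orthonormal eigenvectors, where \<open>n + 1\<close> is the size of \<open>A\<close>.\<close>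

definition negative_eigensystem :: "real mat \<Rightarrow> (nat \<Rightarrow> real) \<Rightarrow> (nat \<Rightarrow> real Matrix.vec) \<Rightarrow> bool" where
  "negative_eigensystem A \<tau> v \<longleftrightarrow>
     (\<forall>j < dim_row A. 0 < \<tau> j \<and> eigenvector A (v j) (- \<tau> j)) \<and>
     (\<forall>j < dim_row A. \<forall>k < dim_row A. v j \<bullet>v v k = (if j = k then 1 else 0))"

end

theory Submission
  imports Defs
begin

text \<open>At a fixed point of the body everything is a linear system of ordinary differential equations in
time. Isotropy splits it into two independent systems of the same shape: if \<open>P\<close> is the trace or
the deviator, then \<open>P\<close> maps \<open>C\<^sub>i \<alpha>\<close> to \<open>c\<^sub>i P \<alpha>\<close>, with \<open>c\<^sub>i = 3 \<lambda>\<^sub>i + 2 \<mu>\<^sub>i\<close> for the trace and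
\<open>c\<^sub>i = 2 \<mu>\<^sub>i\<close> for the deviator.

Each of them becomes symmetric in the variables \<open>w\<^sub>0 = \<surd>c\<^sub>0 P \<psi>\<close> and \<open>w\<^sub>i = \<surd>c\<^sub>i P \<phi>\<^sub>i\<close>
(\<open>burgers_relaxation\<close>): differentiating \<open>\<psi> = e - \<Sum>\<^sub>i \<phi>\<^sub>i\<close> and inserting the flow rules gives
\<open>w' = L w + \<surd>c\<^sub>0 (P e)' \<epsilon>\<^sub>0\<close>, where \<open>\<epsilon>\<^sub>0\<close> is the unit vector of index \<open>0\<close> and \<open>L\<close> is the
relaxation matrix, and \<open>w\<close> vanishes initially. The coefficient \<open>v\<^sup>j \<bullet> w\<close> along an eigenvector of
eigenvalue \<open>- \<tau>\<^sub>j\<close> then solves a scalar equation, whose solution is the convolution of its forcing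
\<open>\<surd>c\<^sub>0 v\<^sup>j\<^sub>0 (P e)'\<close> with \<open>exp (- \<tau>\<^sub>j t)\<close>. Since the eigenvectors are complete,
\<open>w\<^sub>0 = \<Sum>\<^sub>j v\<^sup>j\<^sub>0 (v\<^sup>j \<bullet> w)\<close>, and this is where the weights \<open>(v\<^sup>j\<^sub>0)\<^sup>2\<close> come from
(\<open>forced_symmetric_system\<close>). The stress is recombined from trace and deviator of \<open>\<psi>\<close>.

The second formula is the first one integrated by parts (\<open>relaxation_integral_by_parts\<close>); its
instantaneous term has coefficient \<open>\<Sum>\<^sub>j (v\<^sup>j\<^sub>0)\<^sup>2 = 1\<close>, again by completeness.\<close>

section \<open>Linear systems with a symmetric matrix\<close>

text \<open>The matrix \<open>V\<close> with rows \<open>v j\<close> satisfies \<open>V V\<^sup>T = 1\<close> by orthonormality; a one-sided inverse of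
a square matrix is two-sided, and \<open>V\<^sup>T V = 1\<close> is the claim.\<close>

lemma orthonormal_system_complete:
  assumes orth: "\<forall>j<N. \<forall>k<N. v j \<bullet>v v k = (if j = k then 1 else 0)"
    and dim: "\<And>j. j < N \<Longrightarrow> v j \<in> carrier_vec N"
    and k: "k < N" and l: "l < N"
  shows "(\<Sum>j<N. v j $v k * v j $v l) = (if k = l then 1 else (0::real))"
proof -
  define V where "V = Matrix.mat N N (\<lambda>(i, j). v i $v j)"
  have V: "V \<in> carrier_mat N N" "transpose_mat V \<in> carrier_mat N N"
    by (auto simp: V_def)
  have "V * transpose_mat V = 1\<^sub>m N"
  proof (rule eq_matI)
    fix i j assume "i < dim_row (1\<^sub>m N)" "j < dim_col (1\<^sub>m N)"
    then have ij: "i < N" "j < N" by auto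
    then have "(V * transpose_mat V) $$ (i, j) = v i \<bullet>v v j"
      using dim[of j] by (auto simp: V_def scalar_prod_def intro!: sum.cong)
    then show "(V * transpose_mat V) $$ (i, j) = 1\<^sub>m N $$ (i, j)"
      using orth ij by simp
  qed (auto simp: V_def)
  then have "transpose_mat V * V = 1\<^sub>m N"
    using V mat_mult_left_right_inverse by blast
  then have "(transpose_mat V * V) $$ (k, l) = 1\<^sub>m N $$ (k, l)" by simp
  moreover have "(transpose_mat V * V) $$ (k, l) = (\<Sum>j<N. v j $v k * v j $v l)"
    using k l by (auto simp: V_def scalar_prod_def lessThan_atLeast0 intro!: sum.cong)
  ultimately show ?thesis using k l by simp
qed

text \<open>With \<open>exp (- (t - s) \<tau>)\<close> as integrating factor the integrand is an exact derivative in \<open>s\<close>, so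
it is integrable even when \<open>y'\<close> is not continuous. The lemma serves twice: with \<open>y' + \<tau> y\<close> a given
forcing it solves the equation of a mode, and with \<open>y\<close> the strain it is the integration by parts.\<close>

lemma exp_weighted_has_integral:
  fixes y :: "real \<Rightarrow> 'a :: banach"
  assumes "\<And>s. s \<ge> 0 \<Longrightarrow> (y has_vector_derivative y' s) (at s within {0..})" and "t \<ge> 0"
  shows "((\<lambda>s. exp (- (t - s) * \<tau>) *\<^sub>R (y' s + \<tau> *\<^sub>R y s)) has_integral
           (y t - exp (- t * \<tau>) *\<^sub>R y 0)) {0..t}"
proof -
  have "((\<lambda>s. exp (- (t - s) * \<tau>) *\<^sub>R y s) has_vector_derivative
          exp (- (t - s) * \<tau>) *\<^sub>R (y' s + \<tau> *\<^sub>R y s)) (at s within {0..t})"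
    if s: "s \<in> {0..t}" for s
  proof -
    have "(y has_vector_derivative y' s) (at s within {0..t})"
      using assms(1)[of s] s by (auto intro: has_vector_derivative_within_subset)
    moreover have "((\<lambda>s. exp (- (t - s) * \<tau>)) has_real_derivative
          exp (- (t - s) * \<tau>) * \<tau>) (at s within {0..t})"
      by (auto intro!: derivative_eq_intros)
    ultimately show ?thesis
      using has_vector_derivative_scaleR by (fastforce simp: algebra_simps)
  qed
  from fundamental_theorem_of_calculus[OF \<open>t \<ge> 0\<close> this] show ?thesis by simp
qed

text \<open>Symmetry is what makes \<open>v j\<close> a left eigenvector too, so that the coefficients of \<open>w\<close> along
the \<open>v j\<close> decouple.\<close>

lemma forced_symmetric_system:
  fixes w :: "nat \<Rightarrow> real \<Rightarrow> 'a :: banach"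
  assumes A: "A \<in> carrier_mat (n + 1) (n + 1)"
    and sym: "\<And>i k. i \<le> n \<Longrightarrow> k \<le> n \<Longrightarrow> A $$ (i, k) = A $$ (k, i)"
    and eig: "negative_eigensystem A \<tau> v"
    and ode: "\<And>i s. i \<le> n \<Longrightarrow> s \<ge> 0 \<Longrightarrow> (w i has_vector_derivative
        (\<Sum>k=0..n. A $$ (i, k) *\<^sub>R w k s) + (if i = 0 then g s else 0)) (at s within {0..})"
    and init: "\<And>i. i \<le> n \<Longrightarrow> w i 0 = 0"
    and t: "t \<ge> 0"
  shows "((\<lambda>s. \<Sum>j=0..n. ((v j $v 0)\<^sup>2 * exp (- (t - s) * \<tau> j)) *\<^sub>R g s) has_integral w 0 t) {0..t}"
proof -
  define y where "y j s = (\<Sum>i=0..n. (v j $v i) *\<^sub>R w i s)" for j s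
  have dim: "v j \<in> carrier_vec (n + 1)" if "j < n + 1" for j
    using eig A that by (auto simp: negative_eigensystem_def eigenvector_def)
  have left: "(\<Sum>i=0..n. v j $v i * A $$ (i, k)) = - \<tau> j * v j $v k" if "j \<le> n" "k \<le> n" for j k
  proof -
    have "A *\<^sub>v v j = - \<tau> j \<cdot>\<^sub>v v j"
      using eig A that by (auto simp: negative_eigensystem_def eigenvector_def)
    then have "(A *\<^sub>v v j) $v k = (- \<tau> j \<cdot>\<^sub>v v j) $v k" by simp
    then show ?thesis
      using A dim[of j] that sym
      by (auto simp: scalar_prod_def mult.commute atLeastLessThanSuc_atLeastAtMost intro!: sum.cong)
  qed
  have y': "(y j has_vector_derivative (v j $v 0) *\<^sub>R g s - \<tau> j *\<^sub>R y j s) (at s within {0..})"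
    if "j \<le> n" "s \<ge> 0" for j s
  proof -
    have "(y j has_vector_derivative
        (\<Sum>i=0..n. (v j $v i) *\<^sub>R ((\<Sum>k=0..n. A $$ (i, k) *\<^sub>R w k s) + (if i = 0 then g s else 0))))
        (at s within {0..})"
      unfolding y_def[abs_def] using ode that
      by (intro has_vector_derivative_sum bounded_linear.has_vector_derivative[OF bounded_linear_scaleR_right]) auto
    moreover have "(\<Sum>i=0..n. (v j $v i) *\<^sub>R (\<Sum>k=0..n. A $$ (i, k) *\<^sub>R w k s))
        = (\<Sum>k=0..n. (\<Sum>i=0..n. v j $v i * A $$ (i, k)) *\<^sub>R w k s)"
      by (simp add: scaleR_sum_right scaleR_sum_left) (rule sum.swap)
    moreover have "\<dots> = - \<tau> j *\<^sub>R y j s"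
      using that by (simp add: left y_def scaleR_sum_right sum_negf)
    moreover have "(\<Sum>i=0..n. (v j $v i) *\<^sub>R (if i = 0 then g s else 0)) = (v j $v 0) *\<^sub>R g s"
      by (simp add: if_distrib cong: if_cong)
    ultimately show ?thesis
      by (simp add: scaleR_add_right sum.distrib)
  qed
  have mode: "((\<lambda>s. (v j $v 0) *\<^sub>R (exp (- (t - s) * \<tau> j) *\<^sub>R ((v j $v 0) *\<^sub>R g s)))
      has_integral (v j $v 0) *\<^sub>R y j t) {0..t}" if "j \<in> {0..n}" for j
  proof -
    have "y j 0 = 0" using init by (simp add: y_def)
    moreover have "((\<lambda>s. exp (- (t - s) * \<tau> j) *\<^sub>R (((v j $v 0) *\<^sub>R g s - \<tau> j *\<^sub>R y j s) + \<tau> j *\<^sub>R y j s))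
        has_integral (y j t - exp (- t * \<tau> j) *\<^sub>R y j 0)) {0..t}"
      using y' t that by (intro exp_weighted_has_integral) auto
    ultimately show ?thesis by (intro has_integral_cmul) simp
  qed
  have "((\<lambda>s. \<Sum>j=0..n. (v j $v 0) *\<^sub>R (exp (- (t - s) * \<tau> j) *\<^sub>R ((v j $v 0) *\<^sub>R g s)))
      has_integral (\<Sum>j=0..n. (v j $v 0) *\<^sub>R y j t)) {0..t}"
    by (intro has_integral_sum mode) auto
  moreover have "(\<Sum>j=0..n. (v j $v 0) *\<^sub>R y j t) = w 0 t"
  proof -
    have "(\<Sum>j=0..n. (v j $v 0) *\<^sub>R y j t) = (\<Sum>i=0..n. (\<Sum>j<n+1. v j $v 0 * v j $v i) *\<^sub>R w i t)"
      unfolding y_def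
      by (simp add: scaleR_sum_right scaleR_sum_left lessThan_Suc_atMost atLeast0AtMost) (rule sum.swap)
    also have "\<dots> = (\<Sum>i=0..n. (if 0 = i then 1 else 0) *\<^sub>R w i t)"
      using eig A dim
      by (intro sum.cong refl, subst orthonormal_system_complete) (auto simp: negative_eigensystem_def)
    also have "\<dots> = w 0 t" by (simp add: if_distrib[of "\<lambda>a. a *\<^sub>R _"] cong: if_cong)
    finally show ?thesis .
  qed
  ultimately show ?thesis by (simp add: power2_eq_square mult_ac)
qed

section \<open>Relaxation of an isotropic component\<close>

text \<open>The common form of the two relaxation matrices: \<open>c\<close> stands for \<open>2 \<mu>\<close> (deviator) or
\<open>3 \<lambda> + 2 \<mu>\<close> (trace).\<close>

definition relaxation_matrix :: "nat \<Rightarrow> (nat \<Rightarrow> real) \<Rightarrow> (nat \<Rightarrow> real) \<Rightarrow> real mat" where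
  "relaxation_matrix n \<eta> c = Matrix.mat (n + 1) (n + 1) (\<lambda>(i, j).
     if i = 0 \<and> j = 0 then - (\<Sum>k=0..n. inverse (\<eta> k)) * c 0
     else if i = j then - inverse (\<eta> i) * c i
     else if i = 0 then inverse (\<eta> j) * sqrt (c 0 * c j)
     else if j = 0 then inverse (\<eta> i) * sqrt (c 0 * c i)
     else 0)"

lemma L1S_eq_relaxation_matrix: "L1S n \<eta> mu = relaxation_matrix n \<eta> (\<lambda>i. 2 * mu i)"
  by (rule eq_matI) (auto simp: L1S_def relaxation_matrix_def)

lemma L0S_eq_relaxation_matrix:
  "L0S n \<eta> lam mu = relaxation_matrix n \<eta> (\<lambda>i. 3 * lam i + 2 * mu i)"
  by (rule eq_matI) (auto simp: L0S_def relaxation_matrix_def)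

text \<open>The scaling by \<open>\<surd>c\<^sub>i\<close> in \<open>w\<close> is the one that symmetrises the system: in the
unscaled variables the entry \<open>(0, i)\<close> is \<open>c\<^sub>i / \<eta>\<^sub>i\<close> and the entry \<open>(i, 0)\<close> is \<open>c\<^sub>0 / \<eta>\<^sub>i\<close>,
and after scaling both become \<open>\<surd>(c\<^sub>0 c\<^sub>i) / \<eta>\<^sub>i\<close>.\<close>

lemma burgers_relaxation:
  fixes e \<psi> :: "real \<Rightarrow> 'a :: banach"
  assumes pos: "\<And>i. i \<le> n \<Longrightarrow> \<eta> i > 0 \<and> c i > 0"
    and de: "\<And>s. s \<ge> 0 \<Longrightarrow> (e has_vector_derivative e' s) (at s within {0..})"
    and d\<phi>: "\<And>i s. i \<le> n \<Longrightarrow> s \<ge> 0 \<Longrightarrow> (\<phi> i has_vector_derivative \<phi>' i s) (at s within {0..})"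
    and \<psi>: "\<And>s. s \<ge> 0 \<Longrightarrow> \<psi> s = e s - (\<Sum>i=0..n. \<phi> i s)"
    and flow0: "\<And>s. s \<ge> 0 \<Longrightarrow> \<eta> 0 *\<^sub>R \<phi>' 0 s = c 0 *\<^sub>R \<psi> s"
    and flow: "\<And>i s. i \<in> {1..n} \<Longrightarrow> s \<ge> 0 \<Longrightarrow> \<eta> i *\<^sub>R \<phi>' i s = c 0 *\<^sub>R \<psi> s - c i *\<^sub>R \<phi> i s"
    and init: "\<psi> 0 = 0" "\<And>i. i \<in> {1..n} \<Longrightarrow> \<phi> i 0 = 0"
    and eig: "negative_eigensystem (relaxation_matrix n \<eta> c) \<tau> v"
    and t: "t \<ge> 0"
  shows "((\<lambda>s. \<Sum>j=0..n. ((v j $v 0)\<^sup>2 * exp (- (t - s) * \<tau> j)) *\<^sub>R e' s) has_integral \<psi> t) {0..t}"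
proof -
  define w where "w i s = (if i = 0 then sqrt (c 0) *\<^sub>R \<psi> s else sqrt (c i) *\<^sub>R \<phi> i s)" for i s
  let ?A = "relaxation_matrix n \<eta> c"
  have "c 0 > 0" using pos by auto
  have r: "sqrt (c i) * sqrt (c i) = c i" "\<eta> i \<noteq> 0" if "i \<le> n" for i
    using pos[OF that] by auto
  have \<phi>'0: "\<phi>' 0 s = (inverse (\<eta> 0) * c 0) *\<^sub>R \<psi> s" if "s \<ge> 0" for s
  proof -
    have "inverse (\<eta> 0) *\<^sub>R (\<eta> 0 *\<^sub>R \<phi>' 0 s) = inverse (\<eta> 0) *\<^sub>R (c 0 *\<^sub>R \<psi> s)"
      using flow0[OF that] by simp
    then show ?thesis using r(2)[of 0] by simp
  qed
  have \<phi>': "\<phi>' i s = (inverse (\<eta> i) * c 0) *\<^sub>R \<psi> s - (inverse (\<eta> i) * c i) *\<^sub>R \<phi> i s"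
    if "i \<in> {1..n}" "s \<ge> 0" for i s
  proof -
    have "inverse (\<eta> i) *\<^sub>R (\<eta> i *\<^sub>R \<phi>' i s) = inverse (\<eta> i) *\<^sub>R (c 0 *\<^sub>R \<psi> s - c i *\<^sub>R \<phi> i s)"
      using flow[OF that] by simp
    then show ?thesis using r(2)[of i] that by (simp add: scaleR_diff_right)
  qed
  have row0: "(\<Sum>k=0..n. ?A $$ (0, k) *\<^sub>R w k s) + sqrt (c 0) *\<^sub>R e' s
      = sqrt (c 0) *\<^sub>R (e' s - (\<Sum>i=0..n. \<phi>' i s))" if s: "s \<ge> 0" for s
  proof -
    \<comment> \<open>Up to the factor \<open>\<surd>c\<^sub>0\<close>, the off-diagonal part of row \<open>0\<close>.\<close>
    define S where "S = (\<Sum>k=1..n. (inverse (\<eta> k) * c k) *\<^sub>R \<phi> k s)"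
    have "(\<Sum>k=1..n. ?A $$ (0, k) *\<^sub>R w k s) = sqrt (c 0) *\<^sub>R S"
      unfolding S_def scaleR_sum_right
    proof (intro sum.cong refl)
      fix k assume k: "k \<in> {1..n}"
      then have "?A $$ (0, k) *\<^sub>R w k s = (inverse (\<eta> k) * sqrt (c 0) * (sqrt (c k) * sqrt (c k))) *\<^sub>R \<phi> k s"
        by (simp add: relaxation_matrix_def w_def real_sqrt_mult mult_ac)
      then show "?A $$ (0, k) *\<^sub>R w k s = sqrt (c 0) *\<^sub>R (inverse (\<eta> k) * c k) *\<^sub>R \<phi> k s"
        using k r(1)[of k] by (simp only: atLeastAtMost_iff) (simp add: mult_ac)
    qed
    moreover have "(\<Sum>k=0..n. \<phi>' k s) = ((\<Sum>k=0..n. inverse (\<eta> k)) * c 0) *\<^sub>R \<psi> s - S"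
      using \<phi>' \<phi>'0 s
      by (simp add: sum.atLeast_Suc_atMost[of 0 n] sum_subtractf S_def distrib_right scaleR_add_left
          sum_distrib_right scaleR_sum_left)
    moreover have "?A $$ (0, 0) *\<^sub>R w 0 s
        = - (sqrt (c 0) *\<^sub>R (((\<Sum>k=0..n. inverse (\<eta> k)) * c 0) *\<^sub>R \<psi> s))"
      by (simp add: relaxation_matrix_def w_def mult_ac)
    ultimately show ?thesis
      by (simp add: sum.atLeast_Suc_atMost[of 0 n "\<lambda>k. ?A $$ (0, k) *\<^sub>R w k s"] scaleR_diff_right)
  qed
  have rowi: "(\<Sum>k=0..n. ?A $$ (i, k) *\<^sub>R w k s) = sqrt (c i) *\<^sub>R \<phi>' i s"
    if i: "i \<in> {1..n}" and s: "s \<ge> 0" for i s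
  proof -
    \<comment> \<open>Row \<open>i\<close> has its only nonzero entries in the columns \<open>0\<close> and \<open>i\<close>.\<close>
    have "(\<Sum>k=0..n. ?A $$ (i, k) *\<^sub>R w k s) = (\<Sum>k\<in>{0, i}. ?A $$ (i, k) *\<^sub>R w k s)"
      using i by (intro sum.mono_neutral_right) (auto simp: relaxation_matrix_def)
    also have "\<dots> = (inverse (\<eta> i) * sqrt (c i)) *\<^sub>R ((sqrt (c 0) * sqrt (c 0)) *\<^sub>R \<psi> s)
        - (inverse (\<eta> i) * c i * sqrt (c i)) *\<^sub>R \<phi> i s"
      using i by (auto simp: relaxation_matrix_def w_def real_sqrt_mult mult_ac)
    finally show ?thesis
      unfolding \<phi>'[OF i s] using r(1)[of 0] by (simp only: le0) (simp add: scaleR_diff_right mult_ac)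
  qed
  have ode: "(w i has_vector_derivative
        (\<Sum>k=0..n. ?A $$ (i, k) *\<^sub>R w k s) + (if i = 0 then sqrt (c 0) *\<^sub>R e' s else 0)) (at s within {0..})"
    if i: "i \<le> n" and s: "s \<ge> 0" for i s
  proof (cases "i = 0")
    case True
    have "((\<lambda>s. sqrt (c 0) *\<^sub>R (e s - (\<Sum>i=0..n. \<phi> i s))) has_vector_derivative
        sqrt (c 0) *\<^sub>R (e' s - (\<Sum>i=0..n. \<phi>' i s))) (at s within {0..})"
      using s by (intro bounded_linear.has_vector_derivative[OF bounded_linear_scaleR_right]
          has_vector_derivative_diff has_vector_derivative_sum de d\<phi>) auto
    then have "(w 0 has_vector_derivative sqrt (c 0) *\<^sub>R (e' s - (\<Sum>i=0..n. \<phi>' i s))) (at s within {0..})"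
      by (rule has_vector_derivative_transform[rotated 2]) (use s in \<open>auto simp: w_def \<psi>\<close>)
    then show ?thesis using True row0[OF s] by simp
  next
    case False
    then have "w i = (\<lambda>s. sqrt (c i) *\<^sub>R \<phi> i s)" by (auto simp: w_def)
    moreover have "((\<lambda>s. sqrt (c i) *\<^sub>R \<phi> i s) has_vector_derivative sqrt (c i) *\<^sub>R \<phi>' i s) (at s within {0..})"
      using i s by (intro bounded_linear.has_vector_derivative[OF bounded_linear_scaleR_right] d\<phi>)
    ultimately show ?thesis using False i s rowi[of i s] by simp
  qed
  have "((\<lambda>s. \<Sum>j=0..n. ((v j $v 0)\<^sup>2 * exp (- (t - s) * \<tau> j)) *\<^sub>R (sqrt (c 0) *\<^sub>R e' s))
      has_integral w 0 t) {0..t}"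
    by (rule forced_symmetric_system[where w = w and A = ?A, OF _ _ eig ode _ t])
       (auto simp: relaxation_matrix_def w_def init)
  then have "((\<lambda>s. inverse (sqrt (c 0)) *\<^sub>R
        (\<Sum>j=0..n. ((v j $v 0)\<^sup>2 * exp (- (t - s) * \<tau> j)) *\<^sub>R (sqrt (c 0) *\<^sub>R e' s)))
      has_integral inverse (sqrt (c 0)) *\<^sub>R w 0 t) {0..t}"
    by (rule has_integral_cmul)
  moreover have "(\<Sum>j=0..n. k j *\<^sub>R (sqrt (c 0) *\<^sub>R z)) = sqrt (c 0) *\<^sub>R (\<Sum>j=0..n. k j *\<^sub>R z)"
    for k :: "nat \<Rightarrow> real" and z :: 'a
    by (simp add: scaleR_sum_right mult.commute)
  ultimately show ?thesis
    using \<open>c 0 > 0\<close> by (simp only:) (simp add: w_def)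
qed

text \<open>Adding the two integrands turns each summand into \<open>a j\<close> times the exact derivative of
\<open>exp (- (t - s) \<tau>\<^sub>j) e s\<close>.\<close>

lemma relaxation_integral_by_parts:
  fixes e :: "real \<Rightarrow> 'a :: banach" and n :: nat
  assumes I: "((\<lambda>s. \<Sum>j=0..n. (a j * exp (- (t - s) * \<tau> j)) *\<^sub>R e' s) has_integral p) {0..t}"
    and a: "(\<Sum>j=0..n. a j) = 1"
    and de: "\<And>s. s \<ge> 0 \<Longrightarrow> (e has_vector_derivative e' s) (at s within {0..})"
    and e0: "e 0 = 0" and t: "t \<ge> 0"
  shows "((\<lambda>s. \<Sum>j=0..n. (\<tau> j * a j * exp (- (t - s) * \<tau> j)) *\<^sub>R e s) has_integral (e t - p)) {0..t}"
proof -
  have "((\<lambda>s. \<Sum>j=0..n. a j *\<^sub>R (exp (- (t - s) * \<tau> j) *\<^sub>R (e' s + \<tau> j *\<^sub>R e s)))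
      has_integral (\<Sum>j=0..n. a j *\<^sub>R (e t - exp (- t * \<tau> j) *\<^sub>R e 0))) {0..t}"
    by (intro has_integral_sum has_integral_cmul exp_weighted_has_integral de t) auto
  also have "(\<Sum>j=0..n. a j *\<^sub>R (e t - exp (- t * \<tau> j) *\<^sub>R e 0)) = e t"
    using a by (simp add: e0 flip: scaleR_sum_left)
  finally have "((\<lambda>s. (\<Sum>j=0..n. a j *\<^sub>R (exp (- (t - s) * \<tau> j) *\<^sub>R (e' s + \<tau> j *\<^sub>R e s))) -
      (\<Sum>j=0..n. (a j * exp (- (t - s) * \<tau> j)) *\<^sub>R e' s)) has_integral e t - p) {0..t}"
    using I by (rule has_integral_diff)
  then show ?thesis
    by (simp add: scaleR_add_right sum.distrib mult_ac)
qed

lemma negative_eigensystem_weights: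
  assumes "negative_eigensystem A \<tau> v" and "dim_row A = n + 1"
  shows "(\<Sum>j=0..n. (v j $v 0)\<^sup>2) = 1"
  using orthonormal_system_complete[of "n + 1" v 0 0] assms
  by (auto simp: negative_eigensystem_def eigenvector_def power2_eq_square
      lessThan_Suc_atMost atLeast0AtMost)

section \<open>Trace and deviator of the Burgers model\<close>

lemma time_differentiable_has_vector_derivative:
  assumes "time_differentiable f" and "t \<ge> 0"
  shows "(f has_vector_derivative time_deriv f t) (at t within {0..})"
  using assms unfolding time_differentiable_def time_deriv_def
  by (simp add: vector_derivative_works)

text \<open>The derivative is unique because \<open>0\<close> is not isolated in the half line, even though the
derivative there is only one-sided.\<close>

lemma time_deriv_eqI:
  assumes "(f has_vector_derivative f') (at t within {0..})" and "t \<ge> 0"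
  shows "time_deriv f t = f'"
proof -
  have "{t<..} \<subseteq> {0..}" using \<open>t \<ge> 0\<close> by auto
  then have "at t within {0..} \<noteq> bot"
    using trivial_limit_at_right_real[of t] at_le[of "{t<..}" "{0..}" t]
    by (auto simp: bot_unique)
  then show ?thesis
    unfolding time_deriv_def by (rule vector_derivative_within[OF _ assms(1)])
qed

lemma time_deriv_bounded_linear:
  assumes "bounded_linear P" and "time_differentiable f" and "t \<ge> 0"
  shows "time_deriv (\<lambda>r. P (f r)) t = P (time_deriv f t)"
  using bounded_linear.has_vector_derivative[OF assms(1) time_differentiable_has_vector_derivative[OF assms(2,3)]]
    \<open>t \<ge> 0\<close> by (rule time_deriv_eqI)

text \<open>A linear map \<open>P\<close> under which every elasticity tensor acts as a scalar turns the tensorial model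
into the system with scalar moduli \<open>c\<close>.\<close>

lemma burgers_component:
  fixes P :: "real ^ 3 ^ 3 \<Rightarrow> 'a :: banach"
  assumes P: "bounded_linear P"
    and Pc: "\<And>i \<alpha>. P (elasticity (lam i) (mu i) \<alpha>) = c i *\<^sub>R P \<alpha>"
    and pos: "\<forall>i\<le>n. \<eta> i > 0 \<and> c i > 0"
    and e: "time_differentiable e"
    and model: "burgers_model n \<eta> lam mu e \<phi> \<psi> \<sigma>"
    and init: "(\<forall>i\<in>{1..n}. \<phi> i 0 = 0) \<and> \<psi> 0 = 0"
    and eig: "negative_eigensystem (relaxation_matrix n \<eta> c) \<tau> v"
    and t: "t \<ge> 0"
  shows "((\<lambda>s. \<Sum>j=0..n. ((v j $v 0)\<^sup>2 * exp (- (t - s) * \<tau> j)) *\<^sub>R P (time_deriv e s))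
      has_integral P (\<psi> t)) {0..t}"
    and "e 0 = 0 \<Longrightarrow>
      ((\<lambda>s. \<Sum>j=0..n. (\<tau> j * (v j $v 0)\<^sup>2 * exp (- (t - s) * \<tau> j)) *\<^sub>R P (e s))
      has_integral (P (e t) - P (\<psi> t))) {0..t}"
proof -
  interpret bounded_linear P by fact
  have de: "((\<lambda>r. P (e r)) has_vector_derivative P (time_deriv e s)) (at s within {0..})" if "s \<ge> 0" for s
    by (rule has_vector_derivative[OF time_differentiable_has_vector_derivative[OF e that]])
  have flow: "\<eta> 0 *\<^sub>R P (time_deriv (\<phi> 0) s) = c 0 *\<^sub>R P (\<psi> s)"
    "i \<in> {1..n} \<Longrightarrow> \<eta> i *\<^sub>R P (time_deriv (\<phi> i) s) = c 0 *\<^sub>R P (\<psi> s) - c i *\<^sub>R P (\<phi> i s)"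
    if "s \<ge> 0" for s i
    using model that unfolding burgers_model_def by (auto simp: diff Pc simp flip: scaleR)
  show I: "((\<lambda>s. \<Sum>j=0..n. ((v j $v 0)\<^sup>2 * exp (- (t - s) * \<tau> j)) *\<^sub>R P (time_deriv e s))
      has_integral P (\<psi> t)) {0..t}"
  proof (rule burgers_relaxation[where \<eta> = \<eta> and c = c and \<phi> = "\<lambda>i s. P (\<phi> i s)"
        and \<phi>' = "\<lambda>i s. P (time_deriv (\<phi> i) s)" and e = "\<lambda>s. P (e s)", OF _ de _ _ flow _ _ eig t])
    show "((\<lambda>s. P (\<phi> i s)) has_vector_derivative P (time_deriv (\<phi> i) s)) (at s within {0..})"
      if "i \<le> n" "s \<ge> 0" for i s
      by (rule has_vector_derivative[OF time_differentiable_has_vector_derivative])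
        (use that model in \<open>auto simp: burgers_model_def\<close>)
    show "P (\<psi> s) = P (e s) - (\<Sum>i=0..n. P (\<phi> i s))" if "s \<ge> 0" for s
      using that model by (simp add: burgers_model_def diff sum)
  qed (use pos init in \<open>auto simp: zero\<close>)
  have "dim_row (relaxation_matrix n \<eta> c) = n + 1" by (simp add: relaxation_matrix_def)
  then show "((\<lambda>s. \<Sum>j=0..n. (\<tau> j * (v j $v 0)\<^sup>2 * exp (- (t - s) * \<tau> j)) *\<^sub>R P (e s))
      has_integral (P (e t) - P (\<psi> t))) {0..t}" if "e 0 = 0"
    using that by (intro relaxation_integral_by_parts[OF I] negative_eigensystem_weights[OF eig] de t)
      (auto simp: zero)
qed

definition deviator :: "real ^ 3 ^ 3 \<Rightarrow> real ^ 3 ^ 3" where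
  "deviator \<alpha> = \<alpha> - (1/3 * trace \<alpha>) *\<^sub>R I3"

lemma trace_scaleR: "trace (a *\<^sub>R \<alpha>) = a * trace (\<alpha> :: real ^ 'n ^ 'n)"
  by (simp add: trace_def sum_distrib_left)

lemma trace_I3: "trace I3 = 3"
  by (simp add: trace_def mat_def)

lemma bounded_linear_trace: "bounded_linear (trace :: real ^ 'n ^ 'n \<Rightarrow> real)"
  by (simp add: linear_iff trace_add trace_scaleR flip: linear_conv_bounded_linear)

lemma bounded_linear_deviator: "bounded_linear deviator"
  unfolding deviator_def
  by (intro bounded_linear_sub bounded_linear_ident bounded_linear_scaleR_const
      bounded_linear_const_mult bounded_linear_trace)

lemma trace_elasticity: "trace (elasticity a m \<alpha>) = (3 * a + 2 * m) * trace \<alpha>"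
  by (simp add: elasticity_def trace_add trace_scaleR trace_I3 algebra_simps)

lemma deviator_elasticity: "deviator (elasticity a m \<alpha>) = (2 * m) *\<^sub>R deviator \<alpha>"
  unfolding deviator_def trace_elasticity
  by (simp add: elasticity_def algebra_simps)

lemma elasticity_decomposition:
  "elasticity a m \<alpha> = ((a + 2/3 * m) * trace \<alpha>) *\<^sub>R I3 + (2 * m) *\<^sub>R deviator \<alpha>"
  by (simp add: elasticity_def deviator_def algebra_simps)

lemma trace_strain: "trace (strain G) = divergence G"
proof -
  have "trace (Finite_Cartesian_Product.transpose G) = trace G"
    by (simp add: trace_def Finite_Cartesian_Product.transpose_def)
  then show ?thesis by (simp add: strain_def divergence_def trace_add trace_scaleR)
qed

section \<open>The stress\<close>

lemma burgers_stress:
  assumes pos: "\<forall>i\<le>n. \<eta> i > 0 \<and> mu i > 0 \<and> 3 * lam i + 2 * mu i > 0"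
    and e: "time_differentiable e"
    and model: "burgers_model n \<eta> lam mu e \<phi> \<psi> \<sigma>"
    and init: "(\<forall>i\<in>{1..n}. \<phi> i 0 = 0) \<and> \<psi> 0 = 0"
    and v: "negative_eigensystem (L1S n \<eta> mu) \<tau> v"
    and q: "negative_eigensystem (L0S n \<eta> lam mu) \<kappa> q"
    and t: "t \<ge> 0"
  shows "\<sigma> t = ((lam 0 + 2/3 * mu 0) *
          integral {0..t} (\<lambda>s. \<Sum>j=0..n. (q j $v 0)\<^sup>2 * exp (- (t - s) * \<kappa> j) *
            time_deriv (\<lambda>r. trace (e r)) s)) *\<^sub>R I3
        + (2 * mu 0) *\<^sub>R
          integral {0..t} (\<lambda>s. \<Sum>j=0..n. ((v j $v 0)\<^sup>2 * exp (- (t - s) * \<tau> j)) *\<^sub>R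
            (time_deriv e s - (1/3 * time_deriv (\<lambda>r. trace (e r)) s) *\<^sub>R I3))"
    and "e 0 = 0 \<Longrightarrow> \<sigma> t = ((lam 0 + 2/3 * mu 0) * trace (e t)) *\<^sub>R I3
        + (2 * mu 0) *\<^sub>R (e t - (1/3 * trace (e t)) *\<^sub>R I3)
        - ((lam 0 + 2/3 * mu 0) *
          integral {0..t} (\<lambda>s. \<Sum>j=0..n. \<kappa> j * (q j $v 0)\<^sup>2 * exp (- (t - s) * \<kappa> j) *
            trace (e s))) *\<^sub>R I3
        - (2 * mu 0) *\<^sub>R
          integral {0..t} (\<lambda>s. \<Sum>j=0..n. (\<tau> j * (v j $v 0)\<^sup>2 * exp (- (t - s) * \<tau> j)) *\<^sub>R
            (e s - (1/3 * trace (e s)) *\<^sub>R I3))"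
proof -
  have \<sigma>: "\<sigma> t = ((lam 0 + 2/3 * mu 0) * trace (\<psi> t)) *\<^sub>R I3 + (2 * mu 0) *\<^sub>R deviator (\<psi> t)"
    using model t by (auto simp only: burgers_model_def elasticity_decomposition)
  have mods: "\<forall>i\<le>n. \<eta> i > 0 \<and> 3 * lam i + 2 * mu i > 0" "\<forall>i\<le>n. \<eta> i > 0 \<and> 2 * mu i > 0"
    using pos by auto
  have trc: "trace (elasticity (lam i) (mu i) \<alpha>) = (3 * lam i + 2 * mu i) *\<^sub>R trace \<alpha>" for i \<alpha>
    by (simp add: trace_elasticity)
  note tr = burgers_component[where P = trace and lam = lam and mu = mu and c = "\<lambda>i. 3 * lam i + 2 * mu i",
      OF bounded_linear_trace trc mods(1) e model init q[unfolded L0S_eq_relaxation_matrix] t]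
  note dv = burgers_component[where P = deviator and lam = lam and mu = mu and c = "\<lambda>i. 2 * mu i",
      OF bounded_linear_deviator deviator_elasticity mods(2) e model init v[unfolded L1S_eq_relaxation_matrix] t]
  have "((\<lambda>s. \<Sum>j=0..n. (q j $v 0)\<^sup>2 * exp (- (t - s) * \<kappa> j) * time_deriv (\<lambda>r. trace (e r)) s)
      has_integral trace (\<psi> t)) {0..t}"
    using tr(1)
    by (rule has_integral_eq[rotated])
       (auto simp: time_deriv_bounded_linear[OF bounded_linear_trace e])
  moreover have "((\<lambda>s. \<Sum>j=0..n. ((v j $v 0)\<^sup>2 * exp (- (t - s) * \<tau> j)) *\<^sub>R
        (time_deriv e s - (1/3 * time_deriv (\<lambda>r. trace (e r)) s) *\<^sub>R I3))
      has_integral deviator (\<psi> t)) {0..t}"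
    using dv(1)
    by (rule has_integral_eq[rotated])
       (auto simp: time_deriv_bounded_linear[OF bounded_linear_trace e] deviator_def)
  ultimately show "\<sigma> t = ((lam 0 + 2/3 * mu 0) *
          integral {0..t} (\<lambda>s. \<Sum>j=0..n. (q j $v 0)\<^sup>2 * exp (- (t - s) * \<kappa> j) *
            time_deriv (\<lambda>r. trace (e r)) s)) *\<^sub>R I3
        + (2 * mu 0) *\<^sub>R
          integral {0..t} (\<lambda>s. \<Sum>j=0..n. ((v j $v 0)\<^sup>2 * exp (- (t - s) * \<tau> j)) *\<^sub>R
            (time_deriv e s - (1/3 * time_deriv (\<lambda>r. trace (e r)) s) *\<^sub>R I3))"
    using \<sigma> by (simp only: integral_unique)
  assume e0: "e 0 = 0"
  have "((\<lambda>s. \<Sum>j=0..n. \<kappa> j * (q j $v 0)\<^sup>2 * exp (- (t - s) * \<kappa> j) * trace (e s))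
      has_integral (trace (e t) - trace (\<psi> t))) {0..t}"
    using tr(2)[OF e0] by simp
  then show "\<sigma> t = ((lam 0 + 2/3 * mu 0) * trace (e t)) *\<^sub>R I3
        + (2 * mu 0) *\<^sub>R (e t - (1/3 * trace (e t)) *\<^sub>R I3)
        - ((lam 0 + 2/3 * mu 0) *
          integral {0..t} (\<lambda>s. \<Sum>j=0..n. \<kappa> j * (q j $v 0)\<^sup>2 * exp (- (t - s) * \<kappa> j) *
            trace (e s))) *\<^sub>R I3
        - (2 * mu 0) *\<^sub>R
          integral {0..t} (\<lambda>s. \<Sum>j=0..n. (\<tau> j * (v j $v 0)\<^sup>2 * exp (- (t - s) * \<tau> j)) *\<^sub>R
            (e s - (1/3 * trace (e s)) *\<^sub>R I3))"
    unfolding deviator_def[symmetric] using \<sigma> dv(2)[OF e0]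
    by (simp only: integral_unique)
       (simp add: right_diff_distrib scaleR_diff_left scaleR_diff_right)
qed

theorem mainTheorem1:
  fixes n :: nat and \<Omega> :: "(real ^ 3) set" and \<delta> :: real
    and \<eta> lam mu :: "nat \<Rightarrow> real ^ 3 \<Rightarrow> real"
    and u :: "real \<Rightarrow> real ^ 3 \<Rightarrow> real ^ 3"
    and Du :: "real \<Rightarrow> real ^ 3 \<Rightarrow> real ^ 3 ^ 3"
    and \<phi> :: "nat \<Rightarrow> real \<Rightarrow> real ^ 3 \<Rightarrow> real ^ 3 ^ 3"
    and \<psi> \<sigma> :: "real \<Rightarrow> real ^ 3 \<Rightarrow> real ^ 3 ^ 3"
    and \<tau> \<kappa> :: "nat \<Rightarrow> real ^ 3 \<Rightarrow> real"
    and v q :: "nat \<Rightarrow> real ^ 3 \<Rightarrow> real Matrix.vec"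
  assumes n: "n \<ge> 1"
    and domain: "bounded_lipschitz_domain \<Omega>"
    and coeffs: "\<And>i. i \<le> n \<Longrightarrow> bounded_measurable_on \<Omega> (\<eta> i) \<and>
        bounded_measurable_on \<Omega> (lam i) \<and> bounded_measurable_on \<Omega> (mu i)"
    and delta: "\<delta> > 0"
    and bounds: "\<And>i x. i \<le> n \<Longrightarrow> x \<in> \<Omega> \<Longrightarrow>
        \<eta> i x > 0 \<and> mu i x \<ge> \<delta> \<and> 3 * lam i x + 2 * mu i x \<ge> \<delta>"
    and gradient: "\<And>t. t \<ge> 0 \<Longrightarrow> weak_gradient_on \<Omega> (u t) (Du t)"
    and strain_C1: "AE x in lebesgue_on \<Omega>. time_C1 (\<lambda>t. strain (Du t x))"
    and symmetric: "AE x in lebesgue_on \<Omega>. \<forall>t\<ge>0.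
        (\<forall>i\<in>{0..n}. Finite_Cartesian_Product.transpose (\<phi> i t x) = \<phi> i t x) \<and>
        Finite_Cartesian_Product.transpose (\<psi> t x) = \<psi> t x \<and>
        Finite_Cartesian_Product.transpose (\<sigma> t x) = \<sigma> t x"
    and model: "AE x in lebesgue_on \<Omega>.
        burgers_model n (\<lambda>i. \<eta> i x) (\<lambda>i. lam i x) (\<lambda>i. mu i x) (\<lambda>t. strain (Du t x))
          (\<lambda>i t. \<phi> i t x) (\<lambda>t. \<psi> t x) (\<lambda>t. \<sigma> t x)"
    and initial: "AE x in lebesgue_on \<Omega>. (\<forall>i\<in>{1..n}. \<phi> i 0 x = 0) \<and> \<psi> 0 x = 0"
    and eigen_L1S: "AE x in lebesgue_on \<Omega>.
        negative_eigensystem (L1S n (\<lambda>i. \<eta> i x) (\<lambda>i. mu i x)) (\<lambda>j. \<tau> j x) (\<lambda>j. v j x)"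
    and eigen_L0S: "AE x in lebesgue_on \<Omega>.
        negative_eigensystem (L0S n (\<lambda>i. \<eta> i x) (\<lambda>i. lam i x) (\<lambda>i. mu i x))
          (\<lambda>j. \<kappa> j x) (\<lambda>j. q j x)"
  shows "(AE x in lebesgue_on \<Omega>. \<forall>t\<ge>0.
      \<sigma> t x =
        ((lam 0 x + 2/3 * mu 0 x) *
          integral {0..t} (\<lambda>s. \<Sum>j=0..n. (q j x $v 0)\<^sup>2 * exp (- (t - s) * \<kappa> j x) *
            time_deriv (\<lambda>r. divergence (Du r x)) s)) *\<^sub>R I3
        + (2 * mu 0 x) *\<^sub>R
          integral {0..t} (\<lambda>s. \<Sum>j=0..n. ((v j x $v 0)\<^sup>2 * exp (- (t - s) * \<tau> j x)) *\<^sub>R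
            (time_deriv (\<lambda>r. strain (Du r x)) s
              - (1/3 * time_deriv (\<lambda>r. divergence (Du r x)) s) *\<^sub>R I3)))
    \<and> ((AE x in lebesgue_on \<Omega>. strain (Du 0 x) = 0) \<longrightarrow>
      (AE x in lebesgue_on \<Omega>. \<forall>t\<ge>0.
      \<sigma> t x =
        ((lam 0 x + 2/3 * mu 0 x) * divergence (Du t x)) *\<^sub>R I3
        + (2 * mu 0 x) *\<^sub>R (strain (Du t x) - (1/3 * divergence (Du t x)) *\<^sub>R I3)
        - ((lam 0 x + 2/3 * mu 0 x) *
          integral {0..t} (\<lambda>s. \<Sum>j=0..n. \<kappa> j x * (q j x $v 0)\<^sup>2 * exp (- (t - s) * \<kappa> j x) *
            divergence (Du s x))) *\<^sub>R I3
        - (2 * mu 0 x) *\<^sub>R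
          integral {0..t} (\<lambda>s. \<Sum>j=0..n. (\<tau> j x * (v j x $v 0)\<^sup>2 * exp (- (t - s) * \<tau> j x)) *\<^sub>R
            (strain (Du s x) - (1/3 * divergence (Du s x)) *\<^sub>R I3))))"
proof -
  have pos: "\<eta> i x > 0 \<and> mu i x > 0 \<and> 3 * lam i x + 2 * mu i x > 0" if "i \<le> n" "x \<in> \<Omega>" for i x
    using bounds[OF that] delta by auto
  have inside: "AE x in lebesgue_on \<Omega>. x \<in> \<Omega>"
    using AE_space[of "lebesgue_on \<Omega>"] by (simp add: space_restrict_space)
  note stress = burgers_stress[where \<eta> = "\<lambda>i. \<eta> i x" and lam = "\<lambda>i. lam i x" and mu = "\<lambda>i. mu i x"
      and e = "\<lambda>t. strain (Du t x)" and \<phi> = "\<lambda>i t. \<phi> i t x" and \<psi> = "\<lambda>t. \<psi> t x"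
      and \<sigma> = "\<lambda>t. \<sigma> t x" and \<tau> = "\<lambda>j. \<tau> j x" and v = "\<lambda>j. v j x"
      and \<kappa> = "\<lambda>j. \<kappa> j x" and q = "\<lambda>j. q j x" and n = n for x, unfolded trace_strain]
  show ?thesis
  proof (intro conjI impI, goal_cases)
    case 1
    show ?case
      using inside strain_C1 model initial eigen_L1S eigen_L0S
    proof eventually_elim
      case (elim x)
      have "\<forall>i\<le>n. \<eta> i x > 0 \<and> mu i x > 0 \<and> 3 * lam i x + 2 * mu i x > 0"
        using pos elim(1) by simp
      moreover have "time_differentiable (\<lambda>t. strain (Du t x))"
        using elim(2) by (simp add: time_C1_def)
      ultimately show ?case
        using stress(1)[OF _ _ elim(3-6)] by blast
    qed
  next
    case 2
    show ?case
      using inside strain_C1 model initial eigen_L1S eigen_L0S 2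
    proof eventually_elim
      case (elim x)
      have "\<forall>i\<le>n. \<eta> i x > 0 \<and> mu i x > 0 \<and> 3 * lam i x + 2 * mu i x > 0"
        using pos elim(1) by simp
      moreover have "time_differentiable (\<lambda>t. strain (Du t x))"
        using elim(2) by (simp add: time_C1_def)
      ultimately show ?case
        using stress(2)[OF _ _ elim(3-6) _ elim(7)] by blast
    qed
  qed
qed

end
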